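(* Let $\sigma>0$, $\alpha\in(0,1)$, let $p=p_N,\ q=q_N\in(0,1]$ satisfy $p>q>0$ and $p,q=\omega(\log N/N)$ as $N\to\infty$, and let $\mathcal{G}=(A,X)\sim\mathrm{CSBM}(N,p,q,\mu_1,\mu_2,\sigma^2)$. Let $a=Np/\log N$. With probability at least $1-O(1/N)$, it holds for all $1\le K\le N$ that $$\max\left\{\frac{\alpha^2\min\{a,2\}}{10},\frac1N\right\}\sigma^2\le(\sigma^{\mathrm{PPNP}})^2\le\min\left\{\alpha^2\left(\sum_{k=0}^K(1-\alpha)^k\sqrt{(\sigma^{(k)})^2_{\mathrm{upper}}}+\frac{(1-\alpha)^{K+1}}{\alpha}\sigma\right)^2,\ \sigma^2\right\}.$$
   Context: $\mathrm{CSBM}(N,p,q,\mu_1,\mu_2,\sigma^2)$ (Contextual Stochastic Block Model), $N$ even: the node set $[N]$ is split into two classes $\mathcal{C}_1,\mathcal{C}_2$ of size $N/2$. The symmetric adjacency matrix $A\in\{0,1\}^{N\times N}$ has independent Bernoulli entries $A_{uv}$, $u\le v$, with parameter $p$ if $u,v$ are in the same class and $q$ otherwise. Independently, $X\in\mathbb{R}^N$ has independent entries $X_v\sim\mathcal{N}(\mu_i,\sigma^2)$ for $v\in\mathcal{C}_i$, where $\mu_1<\mu_2$. $D=\mathrm{diag}(A\mathbf{1}_N)$ is the degree matrix (in the stated regime all degrees are positive with high probability; high-probability events are understood to include this). PPNP with teleportation probability $\alpha$ outputs $h^{\mathrm{PPNP}}=\alpha\big(I_N-(1-\alpha)D^{-1}A\big)^{-1}X$.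 $(\sigma^{\mathrm{PPNP}})^2$ is the variance, given $A$, of $h^{\mathrm{PPNP}}_v$ for a node $v$; the bounds are asserted for every node $v$. For integers $n\ge0$, $$(\sigma^{(n)})^2_{\mathrm{upper}}=\min\left\{\sum_{k=0}^{\lfloor n/2\rfloor}\frac{9}{\min\{a,2\}}(n-2k+1)^{2k}(Np)^{n-2k}\left(\frac{2}{N(p+q)}\right)^{2n-2k},\,1\right\}\sigma^2$$ (for $n=0$ this equals $\sigma^2$). The probability is over the random graph $A$. *)

theory Defs
  imports
    "HOL-Probability.Probability"
    "HOL-Library.Landau_Symbols"
    "Jordan_Normal_Form.Gauss_Jordan_Elimination"
begin

text \<open>
  Nodes are \<open>0, \<dots>, N - 1\<close>. The first class is \<open>C\<close>, the second is \<open>{..<N} - C\<close>. All matrices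
  and vectors are those of Jordan_Normal_Form, whose dimension may vary with \<open>N\<close>.
\<close>

text \<open>
  One independent Bernoulli variable for every pair \<open>u \<le> v\<close> (self-loops included), copied
  symmetrically into the adjacency matrix.
\<close>

definition node_pairs :: "nat \<Rightarrow> (nat \<times> nat) set" where
  "node_pairs N = {(u, v). u \<le> v \<and> v < N}"

definition edge_prob :: "nat set \<Rightarrow> real \<Rightarrow> real \<Rightarrow> nat \<times> nat \<Rightarrow> real" where
  "edge_prob C p q = (\<lambda>(u, v). if u \<in> C \<longleftrightarrow> v \<in> C then p else q)"

definition adjacency_mat :: "nat \<Rightarrow> (nat \<times> nat \<Rightarrow> bool) \<Rightarrow> real mat" where
  "adjacency_mat N e = Matrix.mat N N (\<lambda>(u, v). of_bool (e (min u v, max u v)))"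

definition csbm_graph :: "nat \<Rightarrow> nat set \<Rightarrow> real \<Rightarrow> real \<Rightarrow> real mat pmf" where
  "csbm_graph N C p q =
     map_pmf (adjacency_mat N)
       (Pi_pmf (node_pairs N) False (\<lambda>e. bernoulli_pmf (edge_prob C p q e)))"

text \<open>The parameter \<open>\<sigma>\<close> is the standard deviation, not the variance.\<close>

definition csbm_features ::
  "nat \<Rightarrow> nat set \<Rightarrow> real \<Rightarrow> real \<Rightarrow> real \<Rightarrow> (nat \<Rightarrow> real) measure" where
  "csbm_features N C \<mu>1 \<mu>2 \<sigma> =
     (\<Pi>\<^sub>M v\<in>{..<N}. density lborel (normal_density (if v \<in> C then \<mu>1 else \<mu>2) \<sigma>))"

text \<open>The joint law of \<open>(A, X)\<close>.\<close>

definition csbm ::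
  "nat \<Rightarrow> nat set \<Rightarrow> real \<Rightarrow> real \<Rightarrow> real \<Rightarrow> real \<Rightarrow> real \<Rightarrow> (real mat \<times> (nat \<Rightarrow> real)) measure" where
  "csbm N C p q \<mu>1 \<mu>2 \<sigma> =
     measure_pmf (csbm_graph N C p q) \<Otimes>\<^sub>M csbm_features N C \<mu>1 \<mu>2 \<sigma>"

definition node_degree :: "real mat \<Rightarrow> nat \<Rightarrow> real" where
  "node_degree A v = vec_index (A *\<^sub>v Matrix.vec (dim_col A) (\<lambda>_. 1)) v"

definition degree_mat :: "real mat \<Rightarrow> real mat" where
  "degree_mat A = mat_diag (dim_row A) (node_degree A)"

text \<open>The inverse of an invertible square matrix; unspecified for all other matrices.\<close>

definition inv_mat :: "real mat \<Rightarrow> real mat" where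
  "inv_mat M = the (mat_inverse M)"

definition ppnp :: "real \<Rightarrow> real mat \<Rightarrow> real Matrix.vec \<Rightarrow> real Matrix.vec" where
  "ppnp \<alpha> A X =
     \<alpha> \<cdot>\<^sub>v (inv_mat (1\<^sub>m (dim_row A) - (1 - \<alpha>) \<cdot>\<^sub>m (inv_mat (degree_mat A) * A)) *\<^sub>v X)"

text \<open>
  The variance of \<open>Z\<close> under the conditional law \<open>M(\<cdot> | E)\<close>. Since the random graph is discrete,
  conditioning on it means conditioning on the event that it takes a given value; values of
  probability zero play no role in statements about the probability of the graph.
\<close>

definition cond_variance :: "'w measure \<Rightarrow> 'w set \<Rightarrow> ('w \<Rightarrow> real) \<Rightarrow> real" where
  "cond_variance M E Z = prob_space.variance (uniform_measure M E) Z"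

definition ppnp_variance ::
  "nat \<Rightarrow> nat set \<Rightarrow> real \<Rightarrow> real \<Rightarrow> real \<Rightarrow> real \<Rightarrow> real \<Rightarrow> real \<Rightarrow> real mat \<Rightarrow> nat \<Rightarrow> real" where
  "ppnp_variance N C p q \<mu>1 \<mu>2 \<sigma> \<alpha> A v =
     (let M = csbm N C p q \<mu>1 \<mu>2 \<sigma> in
      cond_variance M {\<omega> \<in> space M. fst \<omega> = A}
        (\<lambda>\<omega>. vec_index (ppnp \<alpha> (fst \<omega>) (Matrix.vec N (snd \<omega>))) v))"

definition degree_scale :: "nat \<Rightarrow> real \<Rightarrow> real" where
  "degree_scale N p = real N * p / ln (real N)"

definition sigma_upper_sq :: "nat \<Rightarrow> real \<Rightarrow> real \<Rightarrow> real \<Rightarrow> nat \<Rightarrow> real" where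
  "sigma_upper_sq N p q \<sigma> n =
     min (\<Sum>k = 0..n div 2.
            9 / min (degree_scale N p) 2 * real (n - 2 * k + 1) ^ (2 * k)
            * (real N * p) ^ (n - 2 * k) * (2 / (real N * (p + q))) ^ (2 * n - 2 * k))
         1 * \<sigma>\<^sup>2"

abbreviation even_at_top :: "nat filter" where
  "even_at_top \<equiv> inf at_top (principal {N. even N})"

end

theory Submission
  imports Defs "Jordan_Normal_Form.Determinant"
begin

text \<open>
  Given the graph, PPNP is linear in independent Gaussians, so its variance at \<open>v\<close> is
  \<open>\<sigma>\<^sup>2 \<alpha>\<^sup>2\<close> times the squared norm of row \<open>v\<close> of the resolvent \<open>G = (I - (1 - \<alpha>) D\<inverse> A)\<inverse>\<close>.
  This matrix is nonnegative, has row sums \<open>1 / \<alpha>\<close>, and its diagonal entries are at least 1,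
  which gives both lower bounds and the upper bound \<open>\<sigma>\<^sup>2\<close>.

  The row norms of \<open>(D\<inverse> A)\<^sup>k\<close> are not bounded term by term: in dense graphs already the one
  for \<open>k = 2\<close> exceeds \<open>\<sigma>_upper / \<sigma>\<close>. Instead, let \<open>d = N (p + q) / 2\<close>
  be the expected degree. If all degrees exceed \<open>d / 4\<close>, the entries of \<open>G - I\<close> are \<open>O(1 / d)\<close>, so
  the squared row norm is \<open>1 + O(1 / d)\<close>, whereas the terms \<open>k = 0\<close> and \<open>k = 1\<close> of the claimed bound
  already contribute \<open>(1 + (1 - \<alpha>) / sqrt d)\<^sup>2\<close>. Since \<open>d\<close> tends to infinity this is larger for
  large \<open>N\<close>. The degree condition fails with probability at most \<open>N exp (- d / 4) \<le> 1 / N\<close> by a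
  Chernoff bound.
\<close>

section \<open>Variance of linear functions of Gaussian features\<close>

text \<open>The centered product splits into one factor per coordinate, so Fubini on the finite
  product reduces both claims to one-dimensional normal moments. For \<open>i \<noteq> j\<close> a
  factor has mean zero, and this kills the whole product.\<close>

lemma PiM_normal_covariance:
  fixes m :: "'i \<Rightarrow> real" and \<sigma> :: real
  assumes "\<sigma> > 0" "finite I" "i \<in> I" "j \<in> I"
  defines "M \<equiv> \<Pi>\<^sub>M k\<in>I. density lborel (normal_density (m k) \<sigma>)"
  shows "integrable M (\<lambda>x. (x i - m i) * (x j - m j))"
    and "integral\<^sup>L M (\<lambda>x. (x i - m i) * (x j - m j)) = (if i = j then \<sigma>\<^sup>2 else 0)"
proof -
  let ?D = "\<lambda>k. density lborel (normal_density (m k) \<sigma>)"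
  interpret D: prob_space "?D k" for k
    using assms(1) by (rule prob_space_normal_density)
  interpret product_sigma_finite ?D
    by standard
  have int_eq: "integral\<^sup>L (?D k) g = (\<integral>x. normal_density (m k) \<sigma> x * g x \<partial>lborel)"
    if "g \<in> borel_measurable borel" for k and g :: "real \<Rightarrow> real"
    using that by (subst integral_real_density) auto
  have integrable_iff: "integrable (?D k) g \<longleftrightarrow> integrable lborel (\<lambda>x. normal_density (m k) \<sigma> x * g x)"
    if "g \<in> borel_measurable borel" for k and g :: "real \<Rightarrow> real"
    using that by (subst integrable_real_density) auto
  have int1: "integrable (?D k) (\<lambda>x. x - m k)" and E1: "integral\<^sup>L (?D k) (\<lambda>x. x - m k) = 0" for k
    using integrable_normal_moment[OF assms(1), of "m k" 1] integral_normal_moment_odd[OF assms(1), of "m k" 0]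
    by (simp_all add: int_eq integrable_iff)
  have int2: "integrable (?D k) (\<lambda>x. (x - m k)\<^sup>2)" and E2: "integral\<^sup>L (?D k) (\<lambda>x. (x - m k)\<^sup>2) = \<sigma>\<^sup>2" for k
    using integrable_normal_moment[OF assms(1), of "m k" 2] integral_normal_moment_even[OF assms(1), of "m k" 1]
    by (simp_all add: int_eq integrable_iff power2_eq_square)
  \<comment> \<open>The case \<open>i = j\<close> is separate because one coordinate then carries a
    square, whereas for \<open>i \<noteq> j\<close> two coordinates carry a linear factor
    each.\<close>
  define f where "f k x = (if i = j then (if k = i then (x - m k)\<^sup>2 else 1)
      else (if k = i \<or> k = j then x - m k else 1))" for k x
  have f_int: "integrable (?D k) (f k)" for k
    unfolding f_def by (cases "i = j"; cases "k = i"; cases "k = j") (simp_all add: int1 int2)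
  have f_E: "integral\<^sup>L (?D k) (f k) = (if i = j then (if k = i then \<sigma>\<^sup>2 else 1)
      else (if k = i \<or> k = j then 0 else 1))" for k
    unfolding f_def using D.prob_space by (auto simp: E1 E2)
  have f_prod: "(\<Prod>k\<in>I. f k (x k)) = (x i - m i) * (x j - m j)" for x
  proof (cases "i = j")
    case True
    have "(\<Prod>k\<in>I. f k (x k)) = (\<Prod>k\<in>I. if k = i then (x k - m k)\<^sup>2 else 1)"
      unfolding f_def using True by (intro prod.cong) auto
    then show ?thesis using True assms by (simp add: power2_eq_square)
  next
    case False
    have "(\<Prod>k\<in>I. f k (x k)) = (\<Prod>k\<in>I. (if k = i then x k - m k else 1) * (if k = j then x k - m k else 1))"
      unfolding f_def using False by (intro prod.cong) auto
    then show ?thesis using False assms by (simp add: prod.distrib)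
  qed
  show "integrable M (\<lambda>x. (x i - m i) * (x j - m j))"
    unfolding M_def f_prod[symmetric] using assms f_int by (intro product_integrable_prod) auto
  have "integral\<^sup>L M (\<lambda>x. (x i - m i) * (x j - m j)) = (\<Prod>k\<in>I. integral\<^sup>L (?D k) (f k))"
    unfolding M_def f_prod[symmetric] using assms f_int by (intro product_integral_prod) auto
  also have "\<dots> = (if i = j then \<sigma>\<^sup>2 else 0)"
    unfolding f_E using assms by auto
  finally show "integral\<^sup>L M (\<lambda>x. (x i - m i) * (x j - m j)) = (if i = j then \<sigma>\<^sup>2 else 0)" .
qed

lemma PiM_normal_expectation:
  fixes m :: "'i \<Rightarrow> real" and \<sigma> :: real
  assumes "\<sigma> > 0" "finite I" "i \<in> I"
  defines "M \<equiv> \<Pi>\<^sub>M k\<in>I. density lborel (normal_density (m k) \<sigma>)"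
  shows "integrable M (\<lambda>x. x i)" and "integral\<^sup>L M (\<lambda>x. x i) = m i"
proof -
  let ?D = "\<lambda>k. density lborel (normal_density (m k) \<sigma>)"
  interpret product_prob_space ?D I
    unfolding product_prob_space_def product_prob_space_axioms_def product_sigma_finite_def
    using prob_space_normal_density[OF assms(1)] by (auto intro: prob_space_imp_sigma_finite)
  have dist: "distr M (?D i) (\<lambda>x. x i) = ?D i"
    unfolding M_def using assms by (intro PiM_component)
  have meas: "(\<lambda>x. x i) \<in> measurable M (?D i)"
    unfolding M_def using assms by (intro measurable_component_singleton)
  have "integrable (distr M (?D i) (\<lambda>x. x i)) (\<lambda>x. x)"
    unfolding dist using integrable_normal_moment_nz_1[OF assms(1)]
    by (subst integrable_real_density) auto
  then show "integrable M (\<lambda>x. x i)"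
    by (rule integrable_distr[OF meas])
  have "integral\<^sup>L M (\<lambda>x. x i) = integral\<^sup>L (distr M (?D i) (\<lambda>x. x i)) (\<lambda>x. x)"
    by (rule integral_distr[OF meas, symmetric]) simp
  also have "\<dots> = m i"
    unfolding dist using integral_normal_moment_nz_1[OF assms(1), of "m i"]
    by (subst integral_real_density) auto
  finally show "integral\<^sup>L M (\<lambda>x. x i) = m i" .
qed

lemma PiM_normal_variance_linear:
  fixes m c :: "'i \<Rightarrow> real" and \<sigma> :: real
  assumes "\<sigma> > 0" "finite I"
  defines "M \<equiv> \<Pi>\<^sub>M k\<in>I. density lborel (normal_density (m k) \<sigma>)"
  shows "prob_space.variance M (\<lambda>x. \<Sum>i\<in>I. c i * x i) = \<sigma>\<^sup>2 * (\<Sum>i\<in>I. (c i)\<^sup>2)"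
proof -
  have mean: "integral\<^sup>L M (\<lambda>x. \<Sum>i\<in>I. c i * x i) = (\<Sum>i\<in>I. c i * m i)"
    using PiM_normal_expectation[OF assms(1,2)] unfolding M_def
    by (subst Bochner_Integration.integral_sum) auto
  have sq: "((\<Sum>i\<in>I. c i * x i) - (\<Sum>i\<in>I. c i * m i))\<^sup>2
      = (\<Sum>i\<in>I. \<Sum>j\<in>I. c i * c j * ((x i - m i) * (x j - m j)))" for x
    by (simp add: sum_subtractf[symmetric] power2_eq_square sum_product algebra_simps)
  have int: "integrable M (\<lambda>x. (x i - m i) * (x j - m j))"
    and cov: "integral\<^sup>L M (\<lambda>x. (x i - m i) * (x j - m j)) = (if i = j then \<sigma>\<^sup>2 else 0)"
    if "i \<in> I" "j \<in> I" for i j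
    unfolding M_def using PiM_normal_covariance[OF assms(1,2) that] by auto
  have "integral\<^sup>L M (\<lambda>x. ((\<Sum>i\<in>I. c i * x i) - (\<Sum>i\<in>I. c i * m i))\<^sup>2)
      = (\<Sum>i\<in>I. \<Sum>j\<in>I. c i * c j * (if i = j then \<sigma>\<^sup>2 else 0))"
    unfolding sq
    by (simp add: Bochner_Integration.integral_sum int cov)
  also have "\<dots> = (\<Sum>i\<in>I. c i * c i * \<sigma>\<^sup>2)"
    using assms(2) by (intro sum.cong refl) (simp add: if_distrib cong: if_cong)
  finally show ?thesis
    unfolding mean by (simp add: sum_distrib_left power2_eq_square mult_ac)
qed

section \<open>Conditioning a product law on its discrete component\<close>

text \<open>The event is the rectangle \<open>{a} \<times> space F\<close> of mass
  \<open>pmf P a > 0\<close>. Normalisation cancels this mass, so the second component keeps its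
  law: independence of graph and features, expressed through \<open>uniform_measure\<close>.\<close>

lemma distr_snd_uniform_measure_pair_pmf:
  assumes "prob_space F" "a \<in> set_pmf P"
  defines "M \<equiv> measure_pmf P \<Otimes>\<^sub>M F"
  shows "distr (uniform_measure M {\<omega> \<in> space M. fst \<omega> = a}) F snd = F"
    and "AE \<omega> in uniform_measure M {\<omega> \<in> space M. fst \<omega> = a}. fst \<omega> = a"
proof -
  interpret F: prob_space F by fact
  let ?E = "{\<omega> \<in> space M. fst \<omega> = a}"
  have E: "?E = {a} \<times> space F"
    unfolding M_def by (auto simp: space_pair_measure)
  have em: "emeasure M ({a} \<times> B) = ennreal (pmf P a) * emeasure F B" if "B \<in> sets F" for B
    unfolding M_def using that
    by (subst F.emeasure_pair_measure_Times) (auto simp: emeasure_pmf_single)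
  have E_sets [measurable]: "?E \<in> sets M"
    unfolding E unfolding M_def by auto
  have pos: "pmf P a > 0"
    using assms(2) by (simp add: pmf_positive)
  have emE: "emeasure M ?E = ennreal (pmf P a)"
    unfolding E by (simp add: em F.emeasure_space_1)
  show "AE \<omega> in uniform_measure M ?E. fst \<omega> = a"
    by (rule AE_uniform_measureI[OF E_sets]) auto
  have snd_meas: "snd \<in> measurable (uniform_measure M ?E) F"
    unfolding measurable_cong_sets[OF sets_uniform_measure refl] M_def by simp
  show "distr (uniform_measure M ?E) F snd = F"
  proof (rule measure_eqI)
    fix B assume "B \<in> sets (distr (uniform_measure M ?E) F snd)"
    then have B: "B \<in> sets F" by simp
    then have "B \<subseteq> space F" by (rule sets.sets_into_space)
    have UB: "snd -` B \<inter> space (uniform_measure M ?E) \<in> sets M"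
      using measurable_sets[OF snd_meas B] by simp
    have int: "?E \<inter> (snd -` B \<inter> space (uniform_measure M ?E)) = {a} \<times> B"
      using \<open>B \<subseteq> space F\<close> unfolding E M_def by (auto simp: space_pair_measure)
    have "emeasure (distr (uniform_measure M ?E) F snd) B = ennreal (pmf P a) * emeasure F B / ennreal (pmf P a)"
      using B UB by (simp only: emeasure_distr[OF snd_meas B] emeasure_uniform_measure[OF E_sets UB] int em emE)
    also have "\<dots> = emeasure F B"
      using pos by (subst mult.commute) (simp add: ennreal_mult_divide_eq)
    finally show "emeasure (distr (uniform_measure M ?E) F snd) B = emeasure F B" .
  qed simp
qed

text \<open>Conditioning freezes the first component. \<open>Z\<close> has to agree with
  \<open>g \<circ> snd\<close> only on the event, but it must be measurable on the whole product,
  because the integrals are compared through almost-everywhere equality.\<close>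

lemma cond_variance_pair_pmf:
  assumes "prob_space F" "a \<in> set_pmf P" and g: "g \<in> borel_measurable F"
    and Z_meas: "Z \<in> borel_measurable (measure_pmf P \<Otimes>\<^sub>M F)"
    and Z: "\<And>\<omega>. \<omega> \<in> space (measure_pmf P \<Otimes>\<^sub>M F) \<Longrightarrow> fst \<omega> = a \<Longrightarrow> Z \<omega> = g (snd \<omega>)"
  shows "cond_variance (measure_pmf P \<Otimes>\<^sub>M F) {\<omega> \<in> space (measure_pmf P \<Otimes>\<^sub>M F). fst \<omega> = a} Z
    = prob_space.variance F g"
proof -
  define M where "M = measure_pmf P \<Otimes>\<^sub>M F"
  define U where "U = uniform_measure M {\<omega> \<in> space M. fst \<omega> = a}"
  note facts = distr_snd_uniform_measure_pair_pmf[OF assms(1,2), folded M_def, folded U_def]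
  have snd_meas: "snd \<in> measurable U F"
    unfolding U_def measurable_cong_sets[OF sets_uniform_measure refl] M_def by simp
  have Z_meas': "Z \<in> borel_measurable U"
    using Z_meas unfolding U_def measurable_cong_sets[OF sets_uniform_measure refl] M_def .
  have "AE \<omega> in U. \<omega> \<in> space M"
    using AE_space[of U] by (simp add: U_def)
  with facts(2) have AE: "AE \<omega> in U. Z \<omega> = g (snd \<omega>)"
    by eventually_elim (use Z in \<open>auto simp: M_def\<close>)
  \<comment> \<open>Stated for a general \<open>h\<close>, since the variance uses it twice: for the
    mean and for the squared deviation.\<close>
  have tr: "integral\<^sup>L U (\<lambda>\<omega>. h (Z \<omega>)) = integral\<^sup>L F (\<lambda>x. h (g x))"
    if [measurable]: "h \<in> borel_measurable borel" for h :: "real \<Rightarrow> real"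
  proof -
    have meas: "(\<lambda>x. h (g x)) \<in> borel_measurable F"
      using g by measurable
    have "integral\<^sup>L F (\<lambda>x. h (g x)) = integral\<^sup>L (distr U F snd) (\<lambda>x. h (g x))"
      by (simp add: facts(1))
    also have "\<dots> = integral\<^sup>L U (\<lambda>\<omega>. h (g (snd \<omega>)))"
      by (rule integral_distr[OF snd_meas meas])
    finally have *: "integral\<^sup>L F (\<lambda>x. h (g x)) = integral\<^sup>L U (\<lambda>\<omega>. h (g (snd \<omega>)))" .
    have "integral\<^sup>L U (\<lambda>\<omega>. h (Z \<omega>)) = integral\<^sup>L U (\<lambda>\<omega>. h (g (snd \<omega>)))"
    proof (rule integral_cong_AE)
      show "(\<lambda>\<omega>. h (Z \<omega>)) \<in> borel_measurable U"
        using Z_meas' by measurable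
      show "(\<lambda>\<omega>. h (g (snd \<omega>))) \<in> borel_measurable U"
        using measurable_compose[OF snd_meas meas] .
      show "AE \<omega> in U. h (Z \<omega>) = h (g (snd \<omega>))"
        using AE by eventually_elim simp
    qed
    with * show ?thesis by simp
  qed
  show ?thesis
    unfolding cond_variance_def M_def[symmetric] U_def[symmetric]
    using tr[of "\<lambda>x. x"] tr[of "\<lambda>x. (x - integral\<^sup>L F g)\<^sup>2"] by simp
qed

section \<open>Resolvents of stochastic matrices\<close>

text \<open>A two-sided inverse makes \<open>A\<close> a unit of the matrix ring, so
  \<open>mat_inverse\<close> cannot fail; what it returns equals \<open>B\<close> by uniqueness of
  inverses.\<close>

lemma inv_mat_eqI:
  fixes A B :: "real mat"
  assumes A: "A \<in> carrier_mat n n" and B: "B \<in> carrier_mat n n"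
    and "A * B = 1\<^sub>m n" "B * A = 1\<^sub>m n"
  shows "inv_mat A = B"
proof (cases "mat_inverse A")
  case None
  have "A \<in> Units (ring_mat TYPE(real) n ())"
    using assms unfolding Units_def by (auto simp: ring_mat_simps)
  with mat_inverse(1)[OF A None, where b = "()"] show ?thesis by blast
next
  case (Some B')
  from mat_inverse(2)[OF A Some] have B': "B' * A = 1\<^sub>m n" "B' \<in> carrier_mat n n" by auto
  have "B' = B' * (A * B)"
    using assms B' by simp
  also have "\<dots> = B' * A * B"
    by (rule assoc_mult_mat[symmetric]) (use assms B' in auto)
  also have "\<dots> = B"
    using assms B' by simp
  finally show ?thesis
    by (simp add: inv_mat_def Some)
qed

lemma inv_mat_of_trivial_kernel:
  fixes A :: "real mat"
  assumes A: "A \<in> carrier_mat n n"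
    and ker: "\<And>x. x \<in> carrier_vec n \<Longrightarrow> A *\<^sub>v x = 0\<^sub>v n \<Longrightarrow> x = 0\<^sub>v n"
  shows "inv_mat A \<in> carrier_mat n n" "A * inv_mat A = 1\<^sub>m n" "inv_mat A * A = 1\<^sub>m n"
proof -
  have "Determinant.det A \<noteq> 0"
    using det_0_iff_vec_prod_zero_field[OF A] ker by blast
  then have "A \<in> Units (ring_mat TYPE(real) n ())"
    by (rule det_non_zero_imp_unit[OF A])
  then obtain B where B: "mat_inverse A = Some B"
    using mat_inverse(1)[OF A, where b = "()"] by (cases "mat_inverse A") auto
  from mat_inverse(2)[OF A B] show "inv_mat A \<in> carrier_mat n n" "A * inv_mat A = 1\<^sub>m n" "inv_mat A * A = 1\<^sub>m n"
    by (auto simp: inv_mat_def B)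
qed

lemma index_mult_mat_sum:
  assumes "A \<in> carrier_mat n m" "B \<in> carrier_mat m l" "i < n" "j < l"
  shows "(A * B) $$ (i, j) = (\<Sum>k<m. A $$ (i, k) * B $$ (k, j))"
  using assms by (auto simp: scalar_prod_def atLeast0LessThan)

lemma index_mult_mat_vec_sum:
  assumes "A \<in> carrier_mat n m" "x \<in> carrier_vec m" "i < n"
  shows "vec_index (A *\<^sub>v x) i = (\<Sum>k<m. A $$ (i, k) * vec_index x k)"
  using assms by (auto simp: scalar_prod_def atLeast0LessThan)

text \<open>In the application \<open>P\<close> is the random walk matrix of the graph, and PPNP is
  \<alpha> times the resolvent \<open>G\<close> applied to the features. Row stochasticity is
  isolated here because maximum principles and row sums can replace the Neumann series.\<close>

locale stochastic_resolvent =
  fixes n :: nat and P :: "real mat" and \<alpha> :: real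
  assumes P: "P \<in> carrier_mat n n"
    and P_nonneg: "\<And>i j. i < n \<Longrightarrow> j < n \<Longrightarrow> 0 \<le> P $$ (i, j)"
    and P_row_sum: "\<And>i. i < n \<Longrightarrow> (\<Sum>j<n. P $$ (i, j)) = 1"
    and alpha: "0 < \<alpha>" "\<alpha> < 1"
begin

definition L :: "real mat" where "L = 1\<^sub>m n - (1 - \<alpha>) \<cdot>\<^sub>m P"

definition G :: "real mat" where "G = inv_mat L"

lemma L_carrier: "L \<in> carrier_mat n n"
  unfolding L_def using P by (intro minus_carrier_mat smult_carrier_mat)

lemma L_index: "i < n \<Longrightarrow> j < n \<Longrightarrow> L $$ (i, j) = of_bool (i = j) - (1 - \<alpha>) * P $$ (i, j)"
  using P by (simp add: L_def)

lemma L_mult_vec: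
  assumes "x \<in> carrier_vec n" "i < n"
  shows "vec_index (L *\<^sub>v x) i = vec_index x i - (1 - \<alpha>) * (\<Sum>k<n. P $$ (i, k) * vec_index x k)"
proof -
  have "vec_index (L *\<^sub>v x) i = (\<Sum>k<n. L $$ (i, k) * vec_index x k)"
    by (rule index_mult_mat_vec_sum[OF L_carrier assms])
  also have "\<dots> = (\<Sum>k<n. (if i = k then vec_index x k else 0) - (1 - \<alpha>) * (P $$ (i, k) * vec_index x k))"
    using assms by (intro sum.cong) (auto simp: L_index algebra_simps)
  finally show ?thesis
    using assms by (simp add: sum_subtractf sum_distrib_left)
qed

text \<open>Maximum principle: at a coordinate of largest modulus \<open>?m\<close>, a kernel vector
  equals \<open>1 - \<alpha>\<close> times an average of its coordinates, so
  \<open>?m \<le> (1 - \<alpha>) * ?m\<close>. Dimension 0 is split off because the maximum would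
  range over the empty set.\<close>

lemma L_kernel:
  assumes x: "x \<in> carrier_vec n" and Lx: "L *\<^sub>v x = 0\<^sub>v n"
  shows "x = 0\<^sub>v n"
proof (cases "n = 0")
  case False
  let ?m = "Max ((\<lambda>i. \<bar>vec_index x i\<bar>) ` {..<n})"
  have "?m \<in> (\<lambda>i. \<bar>vec_index x i\<bar>) ` {..<n}"
    using False by (intro Max_in) auto
  then obtain w where w: "w < n" "\<bar>vec_index x w\<bar> = ?m" by auto
  have le: "\<bar>vec_index x k\<bar> \<le> ?m" if "k < n" for k
    using that by (intro Max_ge) auto
  have "vec_index x w = (1 - \<alpha>) * (\<Sum>k<n. P $$ (w, k) * vec_index x k)"
    using L_mult_vec[OF x w(1)] w(1) by (simp add: Lx)
  then have "?m = (1 - \<alpha>) * \<bar>\<Sum>k<n. P $$ (w, k) * vec_index x k\<bar>"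
    using alpha w(2) by (simp add: abs_mult)
  also have "\<dots> \<le> (1 - \<alpha>) * (\<Sum>k<n. P $$ (w, k) * ?m)"
    using alpha w(1) le P_nonneg
    by (intro mult_left_mono order.trans[OF sum_abs] sum_mono) (auto simp: abs_mult intro!: mult_left_mono)
  also have "\<dots> = (1 - \<alpha>) * ?m"
    using P_row_sum[OF w(1)] by (simp flip: sum_distrib_right)
  finally have "\<alpha> * ?m \<le> 0" by (simp add: algebra_simps)
  then have "?m \<le> 0" using alpha by (simp add: mult_le_0_iff)
  with le have "vec_index x k = 0" if "k < n" for k
    using le[OF that] by linarith
  then show ?thesis using x by (intro eq_vecI) auto
qed (use x in auto)

lemma G_carrier: "G \<in> carrier_mat n n" and L_G: "L * G = 1\<^sub>m n" and G_L: "G * L = 1\<^sub>m n"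
  unfolding G_def using inv_mat_of_trivial_kernel[OF L_carrier L_kernel] by auto

text \<open>This form, from \<open>L * G = 1\<close>, averages down a column of \<open>G\<close> and
  suits a minimum principle. Its counterpart \<open>G_right\<close>, from \<open>G * L = 1\<close>,
  stays within a row and serves row sums and entry bounds.\<close>

lemma G_left:
  assumes "i < n" "j < n"
  shows "G $$ (i, j) = of_bool (i = j) + (1 - \<alpha>) * (\<Sum>k<n. P $$ (i, k) * G $$ (k, j))"
proof -
  have "of_bool (i = j) = (\<Sum>k<n. L $$ (i, k) * G $$ (k, j))"
    using index_mult_mat_sum[OF L_carrier G_carrier assms, symmetric] assms by (simp add: L_G)
  also have "\<dots> = (\<Sum>k<n. (if i = k then G $$ (k, j) else 0) - (1 - \<alpha>) * (P $$ (i, k) * G $$ (k, j)))"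
    using assms by (intro sum.cong) (auto simp: L_index algebra_simps)
  also have "\<dots> = G $$ (i, j) - (1 - \<alpha>) * (\<Sum>k<n. P $$ (i, k) * G $$ (k, j))"
    using assms by (simp add: sum_subtractf sum_distrib_left)
  finally show ?thesis by simp
qed

lemma G_right:
  assumes "i < n" "j < n"
  shows "G $$ (i, j) = of_bool (i = j) + (1 - \<alpha>) * (\<Sum>k<n. G $$ (i, k) * P $$ (k, j))"
proof -
  have "of_bool (i = j) = (\<Sum>k<n. G $$ (i, k) * L $$ (k, j))"
    using index_mult_mat_sum[OF G_carrier L_carrier assms, symmetric] assms by (simp add: G_L)
  also have "\<dots> = (\<Sum>k<n. (if k = j then G $$ (i, k) else 0) - (1 - \<alpha>) * (G $$ (i, k) * P $$ (k, j)))"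
    using assms by (intro sum.cong) (auto simp: L_index algebra_simps)
  also have "\<dots> = G $$ (i, j) - (1 - \<alpha>) * (\<Sum>k<n. G $$ (i, k) * P $$ (k, j))"
    using assms by (simp add: sum_subtractf sum_distrib_left)
  finally show ?thesis by simp
qed

text \<open>Minimum principle in column \<open>j\<close>: at a row attaining the minimum
  \<open>?m\<close>, \<open>G_left\<close> gives
  \<open>?m \<ge> (1 - \<alpha>) * ?m\<close>.\<close>

lemma G_nonneg:
  assumes "i < n" "j < n"
  shows "0 \<le> G $$ (i, j)"
proof -
  let ?m = "Min ((\<lambda>i. G $$ (i, j)) ` {..<n})"
  have "?m \<in> (\<lambda>i. G $$ (i, j)) ` {..<n}"
    using assms by (intro Min_in) auto
  then obtain w where w: "w < n" "G $$ (w, j) = ?m" by auto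
  have le: "?m \<le> G $$ (k, j)" if "k < n" for k
    using that by (intro Min_le) auto
  have "(1 - \<alpha>) * ?m = (1 - \<alpha>) * (\<Sum>k<n. P $$ (w, k) * ?m)"
    using P_row_sum[OF w(1)] by (simp flip: sum_distrib_right)
  also have "\<dots> \<le> (1 - \<alpha>) * (\<Sum>k<n. P $$ (w, k) * G $$ (k, j))"
    using alpha w(1) le P_nonneg by (intro mult_left_mono sum_mono) auto
  also have "\<dots> \<le> ?m"
    using G_left[OF w(1) assms(2)] w(2) by simp
  finally have "0 \<le> \<alpha> * ?m" by (simp add: algebra_simps)
  then have "0 \<le> ?m" using alpha by (simp add: zero_le_mult_iff)
  with le[OF assms(1)] show ?thesis by linarith
qed

lemma G_diag_ge_1:
  assumes "i < n"
  shows "1 \<le> G $$ (i, i)"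
proof -
  have "0 \<le> (1 - \<alpha>) * (\<Sum>k<n. P $$ (i, k) * G $$ (k, i))"
    using assms alpha P_nonneg G_nonneg by (intro mult_nonneg_nonneg sum_nonneg) auto
  then show ?thesis using G_left[OF assms assms] by simp
qed

text \<open>Summing \<open>G_right\<close> over the column index gives
  \<open>s = 1 + (1 - \<alpha>) * s\<close> for the row sum \<open>s\<close>, since the rows of
  \<open>P\<close> sum to 1.\<close>

lemma G_row_sum:
  assumes "i < n"
  shows "(\<Sum>j<n. G $$ (i, j)) = 1 / \<alpha>"
proof -
  have "(\<Sum>j<n. G $$ (i, j)) = (\<Sum>j<n. of_bool (i = j) + (1 - \<alpha>) * (\<Sum>k<n. G $$ (i, k) * P $$ (k, j)))"
    using assms by (intro sum.cong refl G_right) auto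
  also have "\<dots> = 1 + (1 - \<alpha>) * (\<Sum>j<n. \<Sum>k<n. G $$ (i, k) * P $$ (k, j))"
    using assms by (simp add: sum.distrib sum_distrib_left of_bool_def)
  also have "(\<Sum>j<n. \<Sum>k<n. G $$ (i, k) * P $$ (k, j)) = (\<Sum>k<n. G $$ (i, k) * (\<Sum>j<n. P $$ (k, j)))"
    by (subst sum.swap) (simp add: sum_distrib_left)
  also have "\<dots> = (\<Sum>k<n. G $$ (i, k))"
    using P_row_sum by simp
  finally have "\<alpha> * (\<Sum>j<n. G $$ (i, j)) = 1" by (simp add: algebra_simps)
  then show ?thesis using alpha by (simp add: field_simps)
qed

section \<open>Bounds on the squared row norms of the resolvent\<close>

text \<open>Cauchy-Schwarz against the all-ones vector, with row sum \<open>1 / \<alpha>\<close>;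
  the source of the \<open>1 / N\<close> in the lower bound.\<close>

lemma row_sq_ge_inverse_dim:
  assumes "i < n"
  shows "1 / real n \<le> \<alpha>\<^sup>2 * (\<Sum>j<n. (G $$ (i, j))\<^sup>2)"
proof -
  have "(\<Sum>j<n. G $$ (i, j))\<^sup>2 \<le> real n * (\<Sum>j<n. (G $$ (i, j))\<^sup>2)"
    using Cauchy_Schwarz_ineq_sum[of "\<lambda>j. G $$ (i, j)" "\<lambda>_. 1" "{..<n}"] by (simp add: mult.commute)
  then have "(1 / \<alpha>)\<^sup>2 \<le> real n * (\<Sum>j<n. (G $$ (i, j))\<^sup>2)"
    by (simp only: G_row_sum[OF assms])
  then have "\<alpha>\<^sup>2 * (1 / \<alpha>)\<^sup>2 \<le> \<alpha>\<^sup>2 * (real n * (\<Sum>j<n. (G $$ (i, j))\<^sup>2))"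
    by (intro mult_left_mono) auto
  then show ?thesis using alpha assms by (simp add: field_simps)
qed

lemma row_sq_ge_1:
  assumes "i < n"
  shows "1 \<le> (\<Sum>j<n. (G $$ (i, j))\<^sup>2)"
proof -
  have "1 \<le> (G $$ (i, i))\<^sup>2"
    using G_diag_ge_1[OF assms] by (simp add: one_le_power)
  also have "\<dots> \<le> (\<Sum>j<n. (G $$ (i, j))\<^sup>2)"
    using assms by (intro member_le_sum) auto
  finally show ?thesis .
qed

text \<open>In a nonnegative row each entry is at most the row sum, so the squared norm is at most
  \<open>(1 / \<alpha>)\<^sup>2\<close>.\<close>

lemma row_sq_le_1:
  assumes "i < n"
  shows "\<alpha>\<^sup>2 * (\<Sum>j<n. (G $$ (i, j))\<^sup>2) \<le> 1"
proof -
  have "(\<Sum>j<n. (G $$ (i, j))\<^sup>2) \<le> (\<Sum>j<n. G $$ (i, j) * (\<Sum>k<n. G $$ (i, k)))"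
    unfolding power2_eq_square using assms
    by (intro sum_mono mult_left_mono member_le_sum) (auto intro: G_nonneg)
  also have "\<dots> = (1 / \<alpha>) * (1 / \<alpha>)"
    by (simp only: sum_distrib_right[symmetric] G_row_sum[OF assms])
  finally show ?thesis using alpha by (simp add: field_simps power2_eq_square)
qed

text \<open>Write row \<open>i\<close> of \<open>G\<close> as the unit vector plus \<open>R\<close>.
  Then \<open>R \<ge> 0\<close> has total mass \<open>?b\<close>, and by \<open>G_right\<close> its
  entries are at most \<open>?b * \<delta>\<close>. Hence the squares of \<open>R\<close> sum to at
  most \<open>?b * (?b * \<delta>)\<close>, and the cross term \<open>2 * R i\<close> is at most
  \<open>2 * ?b * \<delta>\<close>.\<close>

lemma row_sq_upper:
  assumes i: "i < n" and P_le: "\<And>k j. k < n \<Longrightarrow> j < n \<Longrightarrow> P $$ (k, j) \<le> \<delta>"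
  shows "(\<Sum>j<n. (G $$ (i, j))\<^sup>2) \<le> 1 + (2 * ((1 - \<alpha>) / \<alpha>) + ((1 - \<alpha>) / \<alpha>)\<^sup>2) * \<delta>"
proof -
  let ?b = "(1 - \<alpha>) / \<alpha>"
  define R where "R j = G $$ (i, j) - of_bool (i = j)" for j
  have R_nonneg: "0 \<le> R j" if "j < n" for j
    using G_nonneg[OF i that] G_diag_ge_1[OF i] by (auto simp: R_def)
  have R_le: "R j \<le> ?b * \<delta>" if "j < n" for j
  proof -
    have "R j = (1 - \<alpha>) * (\<Sum>k<n. G $$ (i, k) * P $$ (k, j))"
      using G_right[OF i that] by (simp add: R_def)
    also have "\<dots> \<le> (1 - \<alpha>) * (\<Sum>k<n. G $$ (i, k) * \<delta>)"
      using alpha i that by (intro mult_left_mono sum_mono) (auto intro: G_nonneg P_le)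
    also have "\<dots> = ?b * \<delta>"
      by (simp add: sum_distrib_right[symmetric] G_row_sum[OF i])
    finally show ?thesis .
  qed
  have R_sum: "(\<Sum>j<n. R j) = ?b"
    using alpha i by (simp add: R_def sum_subtractf G_row_sum of_bool_def field_simps)
  have "(\<Sum>j<n. (G $$ (i, j))\<^sup>2) = (\<Sum>j<n. (if i = j then 1 + 2 * R j else 0) + (R j)\<^sup>2)"
    by (intro sum.cong) (auto simp: R_def power2_eq_square algebra_simps)
  also have "\<dots> = 1 + 2 * R i + (\<Sum>j<n. R j * R j)"
    using i by (simp add: sum.distrib power2_eq_square)
  also have "(\<Sum>j<n. R j * R j) \<le> (\<Sum>j<n. R j * (?b * \<delta>))"
    using R_nonneg R_le by (intro sum_mono mult_left_mono) auto
  also have "\<dots> = ?b * (?b * \<delta>)"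
    by (simp only: sum_distrib_right[symmetric] R_sum)
  finally have "(\<Sum>j<n. (G $$ (i, j))\<^sup>2) \<le> 1 + 2 * (?b * \<delta>) + ?b * (?b * \<delta>)"
    using R_le[OF i] by linarith
  then show ?thesis
    by (simp only: power2_eq_square distrib_right mult.assoc add.assoc)
qed

end

section \<open>Degree concentration\<close>

lemma exp_minus_one_le_half: "exp (- 1 :: real) \<le> 1 / 2"
  using exp_ge_add_one_self[of "1::real"] by (simp add: exp_minus field_simps)

text \<open>Chernoff bound with exponential parameter 1 for a sum \<open>X\<close> over
  \<open>S\<close>: as \<open>exp (- 1) \<le> 1 / 2\<close>, the expectation of
  \<open>exp (- X)\<close> is at most \<open>exp (- \<mu> / 2)\<close>. Markov's inequality costs a
  factor \<open>exp (\<mu> / 4)\<close>.\<close>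

lemma Pi_pmf_bernoulli_lower_tail:
  fixes r :: "'a \<Rightarrow> real"
  assumes fin: "finite E" and SE: "S \<subseteq> E" and r: "\<And>e. e \<in> E \<Longrightarrow> 0 \<le> r e \<and> r e \<le> 1"
  defines "\<mu> \<equiv> \<Sum>e\<in>S. r e"
  shows "measure_pmf.prob (Pi_pmf E False (\<lambda>e. bernoulli_pmf (r e)))
      {y. (\<Sum>e\<in>S. of_bool (y e)) \<le> \<mu> / 4} \<le> exp (- \<mu> / 4)"
proof -
  let ?Q = "Pi_pmf E False (\<lambda>e. bernoulli_pmf (r e))"
  let ?X = "\<lambda>y. \<Sum>e\<in>S. of_bool (y e) :: real"
  \<comment> \<open>Factors outside \<open>S\<close> are set to 1 so that the product runs over all
    of \<open>E\<close>, the index set of the product distribution.\<close>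
  let ?f = "\<lambda>e b. if e \<in> S then exp (- of_bool b) else 1 :: real"
  have finS: "finite S" using fin SE by (rule finite_subset[rotated])
  have exp_X: "exp (- ?X y) = (\<Prod>e\<in>E. ?f e (y e))" for y
  proof -
    have "exp (- ?X y) = (\<Prod>e\<in>S. exp (- of_bool (y e)))"
      using finS by (simp flip: exp_sum add: sum_negf)
    also have "\<dots> = (\<Prod>e\<in>E. ?f e (y e))"
      using fin SE by (intro prod.mono_neutral_cong_left) auto
    finally show ?thesis .
  qed
  have int: "integrable (measure_pmf ?Q) (\<lambda>y. exp (- ?X y))"
    by (rule measure_pmf.integrable_const_bound[where B = 1]) (auto intro!: sum_nonneg)
  have "measure_pmf.expectation ?Q (\<lambda>y. exp (- ?X y)) = (\<Prod>e\<in>E. measure_pmf.expectation (bernoulli_pmf (r e)) (?f e))"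
    unfolding exp_X using fin
    by (intro expectation_prod_Pi_pmf) (auto intro!: integrable_measure_pmf_finite)
  also have "\<dots> \<le> (\<Prod>e\<in>E. if e \<in> S then exp (- r e / 2) else 1)"
  proof (intro prod_mono conjI)
    fix e assume e: "e \<in> E"
    show "0 \<le> measure_pmf.expectation (bernoulli_pmf (r e)) (?f e)"
      by (intro Bochner_Integration.integral_nonneg) auto
    show "measure_pmf.expectation (bernoulli_pmf (r e)) (?f e) \<le> (if e \<in> S then exp (- r e / 2) else 1)"
    proof (cases "e \<in> S")
      case True
      have "measure_pmf.expectation (bernoulli_pmf (r e)) (?f e) = r e * exp (- 1) + (1 - r e)"
        using True r[OF e] by simp
      also have "\<dots> \<le> r e * (1 / 2) + (1 - r e)"
        using r[OF e] exp_minus_one_le_half by (intro add_right_mono mult_left_mono) auto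
      also have "\<dots> \<le> exp (- r e / 2)"
        using exp_ge_add_one_self[of "- r e / 2"] by simp
      finally show ?thesis using True by simp
    qed simp
  qed
  also have "\<dots> = (\<Prod>e\<in>S. exp (- r e / 2))"
    using fin SE by (intro prod.mono_neutral_cong_right) auto
  also have "\<dots> = exp (- \<mu> / 2)"
    using finS by (simp flip: exp_sum add: \<mu>_def sum_negf sum_divide_distrib)
  finally have mgf: "measure_pmf.expectation ?Q (\<lambda>y. exp (- ?X y)) \<le> exp (- \<mu> / 2)" .
  have "measure_pmf.prob ?Q {y. ?X y \<le> \<mu> / 4} = measure_pmf.expectation ?Q (indicator {y. ?X y \<le> \<mu> / 4})"
    by simp
  \<comment> \<open>Markov's inequality done pointwise: on the event,
    \<open>exp (\<mu> / 4 - X)\<close> is at least 1.\<close>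
  also have "\<dots> \<le> measure_pmf.expectation ?Q (\<lambda>y. exp (\<mu> / 4) * exp (- ?X y))"
  proof (rule integral_mono)
    show "integrable (measure_pmf ?Q) (indicator {y. ?X y \<le> \<mu> / 4} :: _ \<Rightarrow> real)"
      by (rule measure_pmf.integrable_const_bound[where B = 1]) (auto simp: indicator_def)
    show "integrable (measure_pmf ?Q) (\<lambda>y. exp (\<mu> / 4) * exp (- ?X y))"
      using int by simp
    show "indicator {y. ?X y \<le> \<mu> / 4} y \<le> exp (\<mu> / 4) * exp (- ?X y)" for y
      by (simp add: indicator_def flip: exp_add)
  qed
  also have "\<dots> \<le> exp (\<mu> / 4) * exp (- \<mu> / 2)"
    using mgf by simp
  also have "\<dots> = exp (- \<mu> / 4)"
    by (simp flip: exp_add)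
  finally show ?thesis .
qed

section \<open>Node degrees in the block model\<close>

lemma adjacency_mat_carrier: "adjacency_mat N e \<in> carrier_mat N N"
  by (simp add: adjacency_mat_def)

lemma node_degree_eq_sum:
  assumes "A \<in> carrier_mat N N" "v < N"
  shows "node_degree A v = (\<Sum>u<N. A $$ (v, u))"
  using assms by (auto simp: node_degree_def scalar_prod_def atLeast0LessThan)

text \<open>\<open>P\<close> stands for membership of a fixed node in \<open>C\<close>. Both classes
  have \<open>N / 2\<close> members and the self-loop counts as an edge inside the class, so the
  expected degree is exactly the same for all nodes.\<close>

lemma expected_degree:
  fixes p q :: real
  assumes "even N" "C \<subseteq> {..<N}" "card C = N div 2"
  shows "(\<Sum>u<N. if u \<in> C \<longleftrightarrow> P then p else q) = real N * (p + q) / 2"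
proof -
  have fin: "finite C" using assms(2) by (rule finite_subset) simp
  have "(\<Sum>u<N. if u \<in> C \<longleftrightarrow> P then p else q) =
      (\<Sum>u\<in>C. if u \<in> C \<longleftrightarrow> P then p else q) + (\<Sum>u\<in>{..<N} - C. if u \<in> C \<longleftrightarrow> P then p else q)"
    using assms(2) by (subst sum.subset_diff[of C]) auto
  also have "(\<Sum>u\<in>C. if u \<in> C \<longleftrightarrow> P then p else q) = real (card C) * (if P then p else q)"
    by simp
  also have "(\<Sum>u\<in>{..<N} - C. if u \<in> C \<longleftrightarrow> P then p else q) = real (card ({..<N} - C)) * (if P then q else p)"
    by simp
  also have "card ({..<N} - C) = N - N div 2"
    using assms fin by (simp add: card_Diff_subset)
  finally show ?thesis
    using assms by (auto elim!: evenE simp: algebra_simps)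
qed

text \<open>For fixed \<open>v\<close> the map from \<open>u\<close> to the ordered pair
  \<open>(min u v, max u v)\<close> is injective, so the degree of \<open>v\<close> is a sum of
  \<open>N\<close> distinct independent edge variables and the Chernoff bound applies.\<close>

lemma csbm_degree_lower_tail:
  fixes p q :: real
  assumes "even N" "C \<subseteq> {..<N}" "card C = N div 2" "v < N"
    and "0 \<le> p" "p \<le> 1" "0 \<le> q" "q \<le> 1"
  defines "\<mu> \<equiv> real N * (p + q) / 2"
  shows "measure_pmf.prob (csbm_graph N C p q) {A. node_degree A v \<le> \<mu> / 4} \<le> exp (- \<mu> / 4)"
proof -
  let ?h = "\<lambda>u. (min u v, max u v)"
  let ?S = "?h ` {..<N}"
  have inj: "inj_on ?h {..<N}"
    by (rule inj_onI) (auto simp: min_def max_def split: if_splits)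
  have fin: "finite (node_pairs N)"
    by (rule finite_subset[of _ "{..<N} \<times> {..<N}"]) (auto simp: node_pairs_def)
  have SE: "?S \<subseteq> node_pairs N"
    using \<open>v < N\<close> by (auto simp: node_pairs_def)
  have deg: "node_degree (adjacency_mat N e) v = (\<Sum>x\<in>?S. of_bool (e x))" for e
  proof -
    have "node_degree (adjacency_mat N e) v = (\<Sum>u<N. adjacency_mat N e $$ (v, u))"
      by (rule node_degree_eq_sum[OF adjacency_mat_carrier \<open>v < N\<close>])
    also have "\<dots> = (\<Sum>u<N. of_bool (e (?h u)))"
      using \<open>v < N\<close> by (intro sum.cong) (auto simp: adjacency_mat_def min.commute max.commute)
    also have "\<dots> = (\<Sum>x\<in>?S. of_bool (e x))"
      by (simp only: sum.reindex[OF inj] o_def)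
    finally show ?thesis .
  qed
  have "(\<Sum>x\<in>?S. edge_prob C p q x) = (\<Sum>u<N. if u \<in> C \<longleftrightarrow> v \<in> C then p else q)"
    unfolding sum.reindex[OF inj] by (intro sum.cong) (auto simp: edge_prob_def min_def max_def)
  also have "\<dots> = \<mu>"
    unfolding \<mu>_def by (rule expected_degree[OF assms(1-3)])
  finally have mean: "(\<Sum>x\<in>?S. edge_prob C p q x) = \<mu>" .
  have r: "0 \<le> edge_prob C p q x \<and> edge_prob C p q x \<le> 1" for x
    using assms by (cases x) (simp add: edge_prob_def)
  show ?thesis
    using Pi_pmf_bernoulli_lower_tail[OF fin SE, of "edge_prob C p q"] r
    by (simp only: csbm_graph_def measure_map_pmf vimage_def mem_Collect_eq deg mean simp_thms)
qed

text \<open>Union bound: \<open>\<mu> \<ge> 8 * ln N\<close> makes each of the \<open>N\<close>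
  failure probabilities at most \<open>1 / N\<^sup>2\<close>.\<close>

lemma csbm_min_degree_tail:
  fixes p q :: real
  assumes "even N" "C \<subseteq> {..<N}" "card C = N div 2" "0 < N"
    and "0 \<le> p" "p \<le> 1" "0 \<le> q" "q \<le> 1"
  defines "\<mu> \<equiv> real N * (p + q) / 2"
  assumes \<mu>: "8 * ln (real N) \<le> \<mu>"
  shows "measure_pmf.prob (csbm_graph N C p q) {A. \<exists>v<N. node_degree A v \<le> \<mu> / 4} \<le> 1 / real N"
proof -
  have "measure_pmf.prob (csbm_graph N C p q) {A. \<exists>v<N. node_degree A v \<le> \<mu> / 4}
      = measure_pmf.prob (csbm_graph N C p q) (\<Union>v<N. {A. node_degree A v \<le> \<mu> / 4})"
    by (intro arg_cong2[where f = measure]) auto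
  also have "\<dots> \<le> (\<Sum>v<N. measure_pmf.prob (csbm_graph N C p q) {A. node_degree A v \<le> \<mu> / 4})"
    by (intro measure_pmf.finite_measure_subadditive_finite) auto
  also have "\<dots> \<le> (\<Sum>v<N. exp (- \<mu> / 4))"
    unfolding \<mu>_def using assms by (intro sum_mono csbm_degree_lower_tail) auto
  also have "\<dots> \<le> (\<Sum>v<N. exp (- (2 * ln (real N))))"
    using \<mu> by (intro sum_mono) auto
  also have "exp (- (2 * ln (real N))) = 1 / (real N)\<^sup>2"
    using \<open>0 < N\<close> by (simp add: exp_minus exp_double divide_inverse)
  finally show ?thesis
    using \<open>0 < N\<close> by (simp add: power2_eq_square)
qed

section \<open>Variance of PPNP\<close>

lemma csbm_graph_support_carrier:
  assumes "A \<in> set_pmf (csbm_graph N C p q)"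
  shows "A \<in> carrier_mat N N" and "\<And>i j. i < N \<Longrightarrow> j < N \<Longrightarrow> A $$ (i, j) \<in> {0, 1}"
  using assms by (auto simp: csbm_graph_def adjacency_mat_def)

lemma inv_degree_mat:
  assumes "A \<in> carrier_mat N N" "\<forall>v<N. node_degree A v > 0"
  shows "inv_mat (degree_mat A) = mat_diag N (\<lambda>v. 1 / node_degree A v)"
proof (rule inv_mat_eqI[where n = N])
  have one: "mat_diag N (\<lambda>v. node_degree A v * (1 / node_degree A v)) = 1\<^sub>m N"
    "mat_diag N (\<lambda>v. 1 / node_degree A v * node_degree A v) = 1\<^sub>m N"
    using assms(2) by (auto simp: mat_diag_def less_imp_neq[symmetric])
  have dim: "dim_row A = N" using assms(1) by auto
  show "degree_mat A \<in> carrier_mat N N" by (simp add: degree_mat_def dim)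
  show "degree_mat A * mat_diag N (\<lambda>v. 1 / node_degree A v) = 1\<^sub>m N"
    "mat_diag N (\<lambda>v. 1 / node_degree A v) * degree_mat A = 1\<^sub>m N"
    unfolding degree_mat_def dim mat_diag_diag one by auto
qed simp

lemma random_walk_mat_index:
  assumes "A \<in> carrier_mat N N" "\<forall>v<N. node_degree A v > 0"
  shows "inv_mat (degree_mat A) * A = Matrix.mat N N (\<lambda>(i, j). A $$ (i, j) / node_degree A i)"
  unfolding inv_degree_mat[OF assms] mat_diag_mult_left[OF assms(1)] by simp

text \<open>An out-of-range access is determined by index and dimension alone, so it is constant in
  the features. This settles measurability for matrices of the wrong shape.\<close>

lemma vec_index_vec_outside:
  "\<not> i < n \<Longrightarrow> vec_index (Matrix.vec n f) i = vec_index (Matrix.vec n g) i"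
  by transfer (simp add: mk_vec_def)

lemma ppnp_index:
  assumes "v < dim_row B" "B = inv_mat (1\<^sub>m (dim_row A) - (1 - \<alpha>) \<cdot>\<^sub>m (inv_mat (degree_mat A) * A))"
  shows "vec_index (ppnp \<alpha> A (Matrix.vec N x)) v = (\<Sum>u<N. \<alpha> * vec_index (row B v) u * x u)"
  using assms(1) unfolding ppnp_def assms(2)[symmetric]
  by (simp add: scalar_prod_def atLeast0LessThan sum_distrib_left mult.assoc)

(* Outside the dimension of its argument vec_index is an unspecified constant, so measurability
   has to be checked for matrices of all shapes. *)
lemma ppnp_measurable:
  fixes P :: "real mat pmf"
  assumes sets_F: "sets F = sets (\<Pi>\<^sub>M v\<in>{..<N}. borel :: real measure)"
  shows "(\<lambda>\<omega>. vec_index (ppnp \<alpha> (fst \<omega>) (Matrix.vec N (snd \<omega>))) v)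
    \<in> borel_measurable (measure_pmf P \<Otimes>\<^sub>M F)"
proof -
  define B where "B A = inv_mat (1\<^sub>m (dim_row A) - (1 - \<alpha>) \<cdot>\<^sub>m (inv_mat (degree_mat A) * A))" for A
  \<comment> \<open>In range the value is a finite linear form in the features with coefficients
    depending on the graph; out of range it depends on the graph alone. Zero features serve as a
    representative there.\<close>
  have eq: "vec_index (ppnp \<alpha> A (Matrix.vec N x)) v =
      (if v < dim_row (B A) then (\<Sum>u<N. \<alpha> * vec_index (row (B A) v) u * x u)
       else vec_index (ppnp \<alpha> A (Matrix.vec N (\<lambda>_. 0))) v)" for A and x :: "nat \<Rightarrow> real"
  proof (cases "v < dim_row (B A)")
    case True
    then show ?thesis using ppnp_index[OF True B_def] by simp
  next
    case False
    then show ?thesis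
      unfolding ppnp_def B_def[symmetric] smult_vec_def dim_mult_mat_vec
      by (simp only: if_False) (rule vec_index_vec_outside)
  qed
  have fst_meas: "(\<lambda>\<omega>. h (fst \<omega>)) \<in> borel_measurable (measure_pmf P \<Otimes>\<^sub>M F)" for h :: "real mat \<Rightarrow> real"
    by (rule measurable_compose[OF measurable_fst]) simp
  have pred: "Measurable.pred (measure_pmf P \<Otimes>\<^sub>M F) (\<lambda>\<omega>. v < dim_row (B (fst \<omega>)))"
    by (rule measurable_compose[OF measurable_fst]) simp
  have coord: "(\<lambda>\<omega>. snd \<omega> u) \<in> borel_measurable (measure_pmf P \<Otimes>\<^sub>M F)" if "u < N" for u
  proof (rule measurable_compose[OF measurable_snd])
    show "(\<lambda>x. x u) \<in> borel_measurable F"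
      unfolding measurable_cong_sets[OF sets_F refl] using that by (intro measurable_component_singleton) auto
  qed
  show ?thesis
    by (subst eq) (intro measurable_If pred fst_meas borel_measurable_sum borel_measurable_times coord; simp)
qed

text \<open>Positive degrees make \<open>W\<close> row stochastic, so the resolvent locale applies.
  Given \<open>A\<close>, the output is a linear form in the features with coefficients
  \<open>\<alpha> * G $$ (v, u)\<close>; the class means shift only its expectation.\<close>

lemma ppnp_variance_eq:
  assumes A: "A \<in> set_pmf (csbm_graph N C p q)" and "\<sigma> > 0" "0 < \<alpha>" "\<alpha> < 1" and v: "v < N"
    and deg: "\<forall>v<N. node_degree A v > 0"
  defines "W \<equiv> inv_mat (degree_mat A) * A"
  shows "stochastic_resolvent N W \<alpha>"
    and "ppnp_variance N C p q \<mu>1 \<mu>2 \<sigma> \<alpha> A v = \<sigma>\<^sup>2 * (\<alpha>\<^sup>2 * (\<Sum>u<N. (stochastic_resolvent.G N W \<alpha> $$ (v, u))\<^sup>2))"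
proof -
  note cA = csbm_graph_support_carrier(1)[OF A]
  have W: "W = Matrix.mat N N (\<lambda>(i, j). A $$ (i, j) / node_degree A i)"
    unfolding W_def by (rule random_walk_mat_index[OF cA deg])
  interpret stochastic_resolvent N W \<alpha>
  proof
    show "W \<in> carrier_mat N N" by (simp add: W)
    show "0 \<le> W $$ (i, j)" if "i < N" "j < N" for i j
      using that csbm_graph_support_carrier(2)[OF A that] deg by (auto simp: W intro!: divide_nonneg_pos)
    show "(\<Sum>j<N. W $$ (i, j)) = 1" if "i < N" for i
    proof -
      have "(\<Sum>j<N. W $$ (i, j)) = (\<Sum>j<N. A $$ (i, j)) / node_degree A i"
        using that by (simp add: W sum_divide_distrib)
      then show ?thesis
        using deg that node_degree_eq_sum[OF cA that] by (metis divide_self_if less_irrefl)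
    qed
  qed fact+
  show "stochastic_resolvent N W \<alpha>" ..
  have dim: "dim_row A = N" using cA by auto
  define F where "F = csbm_features N C \<mu>1 \<mu>2 \<sigma>"
  have F: "F = (\<Pi>\<^sub>M v\<in>{..<N}. density lborel (normal_density (if v \<in> C then \<mu>1 else \<mu>2) \<sigma>))"
    by (simp add: F_def csbm_features_def)
  have sets_F: "sets F = sets (\<Pi>\<^sub>M v\<in>{..<N}. borel :: real measure)"
    unfolding F by (intro sets_PiM_cong) auto
  have ps: "prob_space F"
    unfolding F using prob_space_normal_density[OF \<open>\<sigma> > 0\<close>] by (intro prob_space_PiM)
  let ?g = "\<lambda>x. \<Sum>u<N. \<alpha> * G $$ (v, u) * x u"
  have g_eq: "vec_index (ppnp \<alpha> A (Matrix.vec N x)) v = ?g x" for x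
  proof -
    have "vec_index (ppnp \<alpha> A (Matrix.vec N x)) v = (\<Sum>u<N. \<alpha> * vec_index (row G v) u * x u)"
      using v G_carrier by (intro ppnp_index) (auto simp: G_def L_def W_def[symmetric] dim)
    then show ?thesis using v G_carrier by simp
  qed
  have g_meas: "?g \<in> borel_measurable F"
    unfolding measurable_cong_sets[OF sets_F refl]
    by (intro borel_measurable_sum borel_measurable_times measurable_component_singleton) auto
  have "ppnp_variance N C p q \<mu>1 \<mu>2 \<sigma> \<alpha> A v = prob_space.variance F ?g"
    unfolding ppnp_variance_def csbm_def Let_def F_def[symmetric]
    by (rule cond_variance_pair_pmf[OF ps A g_meas ppnp_measurable[OF sets_F]]) (simp add: g_eq)
  also have "\<dots> = \<sigma>\<^sup>2 * (\<Sum>u<N. (\<alpha> * G $$ (v, u))\<^sup>2)"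
    unfolding F by (rule PiM_normal_variance_linear[OF \<open>\<sigma> > 0\<close>]) simp
  finally show "ppnp_variance N C p q \<mu>1 \<mu>2 \<sigma> \<alpha> A v = \<sigma>\<^sup>2 * (\<alpha>\<^sup>2 * (\<Sum>u<N. (G $$ (v, u))\<^sup>2))"
    by (simp add: power_mult_distrib sum_distrib_left)
qed

section \<open>The upper bound sequence and the deterministic variance bounds\<close>

lemma sigma_upper_sq_nonneg:
  assumes "0 < degree_scale N p" "0 < p" "0 < q"
  shows "0 \<le> sigma_upper_sq N p q \<sigma> n"
  unfolding sigma_upper_sq_def using assms
  by (intro mult_nonneg_nonneg min.boundedI sum_nonneg) auto

text \<open>The prefactor exceeds 1, so the cap at 1 is active.\<close>

lemma sigma_upper_sq_0:
  assumes "0 < degree_scale N p"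
  shows "sigma_upper_sq N p q \<sigma> 0 = \<sigma>\<^sup>2"
proof -
  have "1 \<le> 9 / min (degree_scale N p) 2"
    using assms by (simp add: field_simps)
  then show ?thesis by (simp add: sigma_upper_sq_def)
qed

text \<open>For \<open>n = 1\<close> only \<open>k = 0\<close> occurs, and its term is the prefactor
  times \<open>N * p / d\<^sup>2\<close>. Since \<open>q \<le> p\<close> gives
  \<open>N * p \<ge> d\<close>, this is at least \<open>1 / d\<close>; the cap respects the bound
  because \<open>d \<ge> 1\<close>.\<close>

lemma sigma_upper_sq_1_ge:
  fixes p q :: real
  assumes "0 < degree_scale N p" "0 < q" "q \<le> p"
  defines "d \<equiv> real N * (p + q) / 2"
  assumes "1 \<le> d"
  shows "\<sigma>\<^sup>2 / d \<le> sigma_upper_sq N p q \<sigma> 1"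
proof -
  have "1 \<le> 9 / min (degree_scale N p) 2"
    using assms by (simp add: field_simps)
  moreover have "1 / d \<le> real N * p * (1 / d)\<^sup>2"
  proof -
    have "d \<le> real N * p"
      using mult_left_mono[OF \<open>q \<le> p\<close>, of "real N"] by (simp add: d_def algebra_simps)
    then have "d * (1 / d)\<^sup>2 \<le> real N * p * (1 / d)\<^sup>2" by (rule mult_right_mono) simp
    then show ?thesis using \<open>1 \<le> d\<close> by (simp add: power2_eq_square)
  qed
  ultimately have "1 * (1 / d) \<le> 9 / min (degree_scale N p) 2 * (real N * p * (1 / d)\<^sup>2)"
    using \<open>1 \<le> d\<close> assms(1) by (intro mult_mono) auto
  moreover have "1 / d = 2 / (real N * (p + q))" by (simp add: d_def)
  ultimately have "1 / d \<le> 9 / min (degree_scale N p) 2 * (real N * p) * (2 / (real N * (p + q)))\<^sup>2"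
    by (simp only: mult_1_left mult.assoc)
  moreover have "1 / d \<le> 1" using \<open>1 \<le> d\<close> by simp
  ultimately have "1 / d * \<sigma>\<^sup>2 \<le> min (9 / min (degree_scale N p) 2 * (real N * p) * (2 / (real N * (p + q)))\<^sup>2) 1 * \<sigma>\<^sup>2"
    by (intro mult_right_mono min.boundedI) auto
  then show ?thesis by (simp add: sigma_upper_sq_def power2_eq_square)
qed

text \<open>The deterministic part: randomness of the graph enters only through the assumed degree
  bound.\<close>

lemma ppnp_variance_bounds:
  fixes p q \<sigma> \<alpha> :: real
  assumes A: "A \<in> set_pmf (csbm_graph N C p q)" and s: "\<sigma> > 0" and a: "0 < \<alpha>" "\<alpha> < 1" and v: "v < N"
    and pq: "0 < q" "q \<le> p" and ds: "0 < degree_scale N p" and K: "1 \<le> K"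
  defines "d \<equiv> real N * (p + q) / 2"
  assumes d: "(12 / \<alpha>\<^sup>2)\<^sup>2 \<le> d" and deg: "\<And>v. v < N \<Longrightarrow> node_degree A v > d / 4"
  shows "max (\<alpha>\<^sup>2 * min (degree_scale N p) 2 / 10) (1 / real N) * \<sigma>\<^sup>2
      \<le> ppnp_variance N C p q \<mu>1 \<mu>2 \<sigma> \<alpha> A v"
    and "ppnp_variance N C p q \<mu>1 \<mu>2 \<sigma> \<alpha> A v
      \<le> min (\<alpha>\<^sup>2 * ((\<Sum>k = 0..K. (1 - \<alpha>) ^ k * sqrt (sigma_upper_sq N p q \<sigma> k))
            + (1 - \<alpha>) ^ (K + 1) / \<alpha> * \<sigma>)\<^sup>2) (\<sigma>\<^sup>2)"
proof -
  have "\<alpha>\<^sup>2 \<le> 1" using a by (simp add: power_le_one)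
  then have c12: "12 \<le> 12 / \<alpha>\<^sup>2" using a by (simp add: field_simps)
  then have "12\<^sup>2 \<le> (12 / \<alpha>\<^sup>2)\<^sup>2" by (rule power_mono) simp
  then have d1: "1 \<le> d" using d by simp
  \<comment> \<open>The form in which the threshold on \<open>d\<close> is used: it lets the
    resolvent correction of order \<open>1 / d\<close> be absorbed into a term of order
    \<open>1 / sqrt d\<close>.\<close>
  have sqrt_d: "12 / \<alpha>\<^sup>2 \<le> sqrt d" using d a by (intro real_le_rsqrt) auto
  have deg_pos: "\<forall>u<N. node_degree A u > 0" using deg d1 by fastforce
  define W where "W = inv_mat (degree_mat A) * A"
  note var = ppnp_variance_eq[OF A s a v deg_pos, folded W_def]
  interpret stochastic_resolvent N W \<alpha> by (rule var(1))
  define V where "V = (\<Sum>u<N. (G $$ (v, u))\<^sup>2)"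
  note var = var(2)[of \<mu>1 \<mu>2, folded V_def]
  have V1: "1 \<le> V" unfolding V_def by (rule row_sq_ge_1[OF v])
  \<comment> \<open>The diagonal entry of \<open>G\<close> alone suffices, as
    \<open>min (degree_scale N p) 2 / 10 \<le> 1 / 5\<close> and \<open>V \<ge> 1\<close>.\<close>
  have "\<alpha>\<^sup>2 * min (degree_scale N p) 2 / 10 \<le> \<alpha>\<^sup>2 * V"
    using V1 a by (simp add: field_simps) 
  then have "max (\<alpha>\<^sup>2 * min (degree_scale N p) 2 / 10) (1 / real N) \<le> \<alpha>\<^sup>2 * V"
    using row_sq_ge_inverse_dim[OF v, folded V_def] by simp
  then show "max (\<alpha>\<^sup>2 * min (degree_scale N p) 2 / 10) (1 / real N) * \<sigma>\<^sup>2
      \<le> ppnp_variance N C p q \<mu>1 \<mu>2 \<sigma> \<alpha> A v"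
    unfolding var by (subst mult.commute[of "\<sigma>\<^sup>2"]) (rule mult_right_mono, auto)
  have W_le: "W $$ (k, j) \<le> 4 / d" if "k < N" "j < N" for k j
  proof -
    note cA = csbm_graph_support_carrier[OF A]
    have "W $$ (k, j) = A $$ (k, j) / node_degree A k"
      unfolding W_def random_walk_mat_index[OF cA(1) deg_pos] using that by simp
    also have "\<dots> \<le> 1 / (d / 4)"
      using cA(2)[OF that] deg[OF that(1)] d1 by (intro frac_le) auto
    finally show ?thesis by simp
  qed
  let ?b = "(1 - \<alpha>) / \<alpha>"
  have "V \<le> 1 + (2 * ?b + ?b\<^sup>2) * (4 / d)"
    unfolding V_def by (rule row_sq_upper[OF v W_le])
  also have "\<dots> \<le> 1 + 2 * (1 - \<alpha>) / sqrt d"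
  proof -
    \<comment> \<open>Here \<open>2 * ?b + ?b\<^sup>2 = (1 - \<alpha>) * (1 + \<alpha>) /
      \<alpha>\<^sup>2\<close>. The factor \<open>1 - \<alpha>\<close> is kept apart because the
      target is proportional to it too; the rest is bounded using
      \<open>4 + 4 * \<alpha> \<le> 12\<close>.\<close>
    have "(2 * ?b + ?b\<^sup>2) * (4 / d) = (1 - \<alpha>) * ((4 + 4 * \<alpha>) / \<alpha>\<^sup>2) / d"
      using a d1 by (simp add: field_simps power2_eq_square)
    also have "\<dots> \<le> (1 - \<alpha>) * (2 * sqrt d) / d"
    proof (intro divide_right_mono mult_left_mono)
      have "(4 + 4 * \<alpha>) / \<alpha>\<^sup>2 \<le> 12 / \<alpha>\<^sup>2"
        using a by (intro divide_right_mono) auto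
      also have "\<dots> \<le> 2 * sqrt d"
        using sqrt_d d1 real_sqrt_ge_zero[of d] by linarith
      finally show "(4 + 4 * \<alpha>) / \<alpha>\<^sup>2 \<le> 2 * sqrt d" .
    qed (use a d1 in auto)
    also have "\<dots> = 2 * (1 - \<alpha>) * (sqrt d / d)" by simp
    also have "sqrt d / d = 1 / sqrt d"
      using d1 by (simp add: field_simps)
    finally show ?thesis by simp
  qed
  also have "\<dots> \<le> (1 + (1 - \<alpha>) / sqrt d)\<^sup>2"
    using zero_le_power2[of "(1 - \<alpha>) / sqrt d"] by (simp only: power2_sum) simp
  finally have V_le: "V \<le> (1 + (1 - \<alpha>) / sqrt d)\<^sup>2" .
  let ?f = "\<lambda>k. (1 - \<alpha>) ^ k * sqrt (sigma_upper_sq N p q \<sigma> k)"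
  have "\<sigma> / sqrt d = sqrt (\<sigma>\<^sup>2 / d)" using s by (simp add: real_sqrt_divide)
  also have "\<dots> \<le> sqrt (sigma_upper_sq N p q \<sigma> 1)"
    using sigma_upper_sq_1_ge[OF ds pq] d1 by (simp add: d_def)
  finally have "(1 - \<alpha>) * (\<sigma> / sqrt d) \<le> (1 - \<alpha>) * sqrt (sigma_upper_sq N p q \<sigma> 1)"
    using a by (intro mult_left_mono) auto
  then have "\<sigma> * (1 + (1 - \<alpha>) / sqrt d) \<le> ?f 0 + ?f 1"
    using s by (simp add: sigma_upper_sq_0[OF ds] algebra_simps)
  \<comment> \<open>\<open>1 \<le> K\<close> puts both indices into the range of summation; the
    other terms and the remainder are nonnegative.\<close>
  also have "\<dots> = (\<Sum>k\<in>{0, 1}. ?f k)" by simp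
  also have "\<dots> \<le> (\<Sum>k = 0..K. ?f k)"
    using K a ds pq by (intro sum_mono2) (auto intro!: mult_nonneg_nonneg sigma_upper_sq_nonneg)
  also have "\<dots> \<le> (\<Sum>k = 0..K. ?f k) + (1 - \<alpha>) ^ (K + 1) / \<alpha> * \<sigma>"
    using a s by simp
  finally have "(\<sigma> * (1 + (1 - \<alpha>) / sqrt d))\<^sup>2 \<le> ((\<Sum>k = 0..K. ?f k) + (1 - \<alpha>) ^ (K + 1) / \<alpha> * \<sigma>)\<^sup>2"
    using a s d1 by (intro power_mono mult_nonneg_nonneg add_nonneg_nonneg) auto
  then have "\<sigma>\<^sup>2 * V \<le> ((\<Sum>k = 0..K. ?f k) + (1 - \<alpha>) ^ (K + 1) / \<alpha> * \<sigma>)\<^sup>2"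
    using mult_left_mono[OF V_le, of "\<sigma>\<^sup>2"] by (simp add: power_mult_distrib)
  then have "\<sigma>\<^sup>2 * (\<alpha>\<^sup>2 * V) \<le> \<alpha>\<^sup>2 * ((\<Sum>k = 0..K. ?f k) + (1 - \<alpha>) ^ (K + 1) / \<alpha> * \<sigma>)\<^sup>2"
    by (subst mult.left_commute) (rule mult_left_mono, auto)
  moreover have "\<sigma>\<^sup>2 * (\<alpha>\<^sup>2 * V) \<le> \<sigma>\<^sup>2"
    using mult_left_mono[OF row_sq_le_1[OF v, folded V_def], of "\<sigma>\<^sup>2"] by simp
  ultimately show "ppnp_variance N C p q \<mu>1 \<mu>2 \<sigma> \<alpha> A v
      \<le> min (\<alpha>\<^sup>2 * ((\<Sum>k = 0..K. ?f k) + (1 - \<alpha>) ^ (K + 1) / \<alpha> * \<sigma>)\<^sup>2) (\<sigma>\<^sup>2)"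
    unfolding var by simp
qed

theorem proposition4:
  fixes \<sigma> \<alpha> \<mu>1 \<mu>2 :: real
    and p q :: "nat \<Rightarrow> real"
    and C :: "nat \<Rightarrow> nat set"
  assumes "\<sigma> > 0" and "0 < \<alpha>" and "\<alpha> < 1" and "\<mu>1 < \<mu>2"
    and classes: "\<And>N. even N \<Longrightarrow> N > 0 \<Longrightarrow> C N \<subseteq> {..<N} \<and> card (C N) = N div 2"
    and probs: "\<And>N. even N \<Longrightarrow> N > 0 \<Longrightarrow> 0 < q N \<and> q N < p N \<and> p N \<le> 1"
    and "p \<in> \<omega>[even_at_top](\<lambda>N. ln (real N) / real N)"
    and "q \<in> \<omega>[even_at_top](\<lambda>N. ln (real N) / real N)"
  shows "(\<lambda>N. 1 - measure_pmf.prob (csbm_graph N (C N) (p N) (q N))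
            {A. (\<forall>v<N. node_degree A v > 0) \<and>
                (\<forall>v<N. \<forall>K\<in>{1..N}.
                   max (\<alpha>\<^sup>2 * min (degree_scale N (p N)) 2 / 10) (1 / real N) * \<sigma>\<^sup>2
                     \<le> ppnp_variance N (C N) (p N) (q N) \<mu>1 \<mu>2 \<sigma> \<alpha> A v \<and>
                   ppnp_variance N (C N) (p N) (q N) \<mu>1 \<mu>2 \<sigma> \<alpha> A v
                     \<le> min (\<alpha>\<^sup>2 * ((\<Sum>k = 0..K. (1 - \<alpha>) ^ k
                                      * sqrt (sigma_upper_sq N (p N) (q N) \<sigma> k))
                                   + (1 - \<alpha>) ^ (K + 1) / \<alpha> * \<sigma>)\<^sup>2)
                           (\<sigma>\<^sup>2))})
         \<in> O[even_at_top](\<lambda>N. 1 / real N)"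
proof -
  let ?F = "even_at_top"
  \<comment> \<open>The factor 16 gives \<open>d \<ge> N * p / 2 \<ge> 8 * ln N\<close>, as the
    union bound over degrees requires.\<close>
  have "eventually (\<lambda>N. norm (p N) \<ge> 16 * norm (ln (real N) / real N)) ?F"
    using landau_omega.smallD[OF assms(7), of 16] by simp
  moreover have "eventually even ?F"
    by (simp add: eventually_inf_principal)
  \<comment> \<open>\<open>2 \<le> N\<close> makes the logarithm positive; the second condition puts
    \<open>d\<close> above the constant threshold of the deterministic bounds.\<close>
  moreover have "eventually (\<lambda>N::nat. 2 \<le> N) ?F" "eventually (\<lambda>N::nat. (12 / \<alpha>\<^sup>2)\<^sup>2 \<le> 8 * ln (real N)) ?F"
  proof -
    have "filterlim (\<lambda>N::nat. 8 * ln (real N)) at_top at_top"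
      by (intro filterlim_tendsto_pos_mult_at_top[OF tendsto_const] filterlim_compose[OF ln_at_top]
          filterlim_real_sequentially) simp
    then have "eventually (\<lambda>N::nat. (12 / \<alpha>\<^sup>2)\<^sup>2 \<le> 8 * ln (real N)) at_top"
      by (simp add: filterlim_at_top)
    then show "eventually (\<lambda>N::nat. (12 / \<alpha>\<^sup>2)\<^sup>2 \<le> 8 * ln (real N)) ?F"
      by (rule filter_leD[OF inf_le1])
    show "eventually (\<lambda>N::nat. 2 \<le> N) ?F"
      by (rule filter_leD[OF inf_le1 eventually_ge_at_top])
  qed
  ultimately show ?thesis
  proof (intro bigoI[where c = 1], eventually_elim)
    case (elim N)
    define d where "d = real N * (p N + q N) / 2"
    have pq: "0 < q N" "q N < p N" "p N \<le> 1" and C: "C N \<subseteq> {..<N}" "card (C N) = N div 2"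
      using probs[of N] classes[of N] elim by auto
    have ln_pos: "0 < ln (real N)" using elim by simp
    have ds: "0 < degree_scale N (p N)"
      using elim pq ln_pos by (simp add: degree_scale_def)
    have "16 * ln (real N) \<le> real N * p N"
      using elim pq ln_pos by (simp add: field_simps)
    moreover have "0 \<le> real N * q N" using pq by simp
    ultimately have d8: "8 * ln (real N) \<le> d"
      by (simp add: d_def algebra_simps)
    then have d12: "(12 / \<alpha>\<^sup>2)\<^sup>2 \<le> d" using elim by linarith
    have "0 < d" using d8 ln_pos by linarith
    let ?M = "csbm_graph N (C N) (p N) (q N)"
    let ?S = "{A. (\<forall>v<N. node_degree A v > 0) \<and>
                (\<forall>v<N. \<forall>K\<in>{1..N}.
                   max (\<alpha>\<^sup>2 * min (degree_scale N (p N)) 2 / 10) (1 / real N) * \<sigma>\<^sup>2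
                     \<le> ppnp_variance N (C N) (p N) (q N) \<mu>1 \<mu>2 \<sigma> \<alpha> A v \<and>
                   ppnp_variance N (C N) (p N) (q N) \<mu>1 \<mu>2 \<sigma> \<alpha> A v
                     \<le> min (\<alpha>\<^sup>2 * ((\<Sum>k = 0..K. (1 - \<alpha>) ^ k
                                      * sqrt (sigma_upper_sq N (p N) (q N) \<sigma> k))
                                   + (1 - \<alpha>) ^ (K + 1) / \<alpha> * \<sigma>)\<^sup>2)
                           (\<sigma>\<^sup>2))}"
    have good: "A \<in> ?S" if A: "A \<in> set_pmf ?M" and deg: "\<And>v. v < N \<Longrightarrow> d / 4 < node_degree A v" for A
    proof -
      have "node_degree A v > 0" if "v < N" for v
        using deg[OF that] \<open>0 < d\<close> by simp
      moreover note ppnp_variance_bounds[OF A assms(1-3) _ pq(1) less_imp_le[OF pq(2)] ds _ d12[unfolded d_def] deg[unfolded d_def], of _ _ \<mu>1 \<mu>2]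
      ultimately show ?thesis by auto
    qed
    have "1 - measure_pmf.prob ?M ?S = measure_pmf.prob ?M (- ?S)"
      using measure_pmf.prob_compl[of ?S ?M] by (simp add: Compl_eq_Diff_UNIV)
    \<comment> \<open>The variance formula holds for graphs in the support, so the failure event is
      restricted to it before comparing with low degrees.\<close>
    also have "\<dots> = measure_pmf.prob ?M (- ?S \<inter> set_pmf ?M)"
      by (simp add: measure_Int_set_pmf)
    also have "\<dots> \<le> measure_pmf.prob ?M {A. \<exists>v<N. node_degree A v \<le> d / 4}"
      using good by (intro measure_pmf.finite_measure_mono) (auto simp: not_le[symmetric])
    also have "\<dots> \<le> 1 / real N"
      unfolding d_def using elim pq d8 C by (intro csbm_min_degree_tail) (auto simp: d_def)
    finally show "norm (1 - measure_pmf.prob ?M ?S) \<le> 1 * norm (1 / real N)"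
      by simp
  qed
qed

end
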